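(* Let $V=V_0+V_1$ be a Lie superalgebra over a field $K$. If $A=(\lambda_A,\rho_A)$ is a CIF Lie sub-superalgebra (respectively CIF ideal) of $V$, then the sets $U(\lambda_A,(t,s))$ and $L(\rho_A,(t,s))$ are Lie sub-superalgebras (respectively ideals) of $V$ for every $(t,s)\in\mathrm{Im}(\lambda_A)\cap\mathrm{Im}(\rho_A)$.
   Context: Complex numbers in the closed unit disk are written $\alpha e^{i2\pi\beta}$ with $\alpha,\beta\in[0,1]$ and are handled through the pair $(\alpha,\beta)$: $\alpha e^{i2\pi\beta}\le\gamma e^{i2\pi\delta}$ means $\alpha\le\gamma$ and $\beta\le\delta$. The symbols $\wedge$ (min), $\vee$ (max), $\sup$, $\inf$ are taken componentwise on such pairs. The value $1$ stands for $1e^{i2\pi\cdot 1}$ and $0$ for $0e^{i2\pi\cdot 0}$. A complex intuitionistic fuzzy (CIF) set on a nonempty set $X$ is a pair $A=(\lambda_A,\rho_A)$ of functions $\lambda_A(x)=r_A(x)e^{i2\pi\omega_A(x)}$, $\rho_A(x)=\hat r_A(x)e^{i2\pi\hat\omega_A(x)}$ with $r_A,\omega_A,\hat r_A,\hat\omega_A:X\to[0,1]$ and $r_A(x)+\hat r_A(x)\le 1$ for all $x$. A CIF set $A$ on a $K$-vector space $V$ is a CIF vector subspace of $V$ if for all $x,y\in V$, $\alpha\in K$: $\lambda_A(x+y)\ge\lambda_A(x)\wedge\lambda_A(y)$, $\rho_A(x+y)\le\rho_A(x)\vee\rho_A(y)$, $\lambda_A(\alpha x)\ge\lambda_A(x)$,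 $\rho_A(\alpha x)\le\rho_A(x)$; moreover it is always assumed that $\lambda_A(0)=1$ and $\rho_A(0)=0$. A Lie superalgebra over $K$ is a $\mathbb{Z}_2$-graded vector space $V=V_0+V_1$ (direct sum) with a bilinear bracket $[\,,]:V\times V\to V$ such that $[V_i,V_j]\subseteq V_{i+j}$; $[x,y]=-(-1)^{|x||y|}[y,x]$; and $[x,[y,z]]-(-1)^{|x||y|}[y,[x,z]]=[[x,y],z]$ for homogeneous elements. A Lie sub-superalgebra (respectively ideal) of $V$ is a $\mathbb{Z}_2$-graded subspace $W=(W\cap V_0)+(W\cap V_1)$ with $[x,y]\in W$ whenever $x,y\in W$ (respectively whenever $x\in W$ or $y\in W$). Given CIF vector subspaces $A_j$ of $V_j$ ($j=0,1$), let $\mathfrak a_j$ be the extension of $A_j$ to $V$: $\lambda_{\mathfrak a_j}=\lambda_{A_j}$, $\rho_{\mathfrak a_j}=\rho_{A_j}$ on $V_j$, and $\lambda_{\mathfrak a_j}=0$, $\rho_{\mathfrak a_j}=1$ off $V_j$. Then $A_0\oplus A_1$ denotes the CIF set $\mathfrak a_0+\mathfrak a_1$ on $V$ given by $\lambda(x)=\sup_{x=a+b}\{\lambda_{\mathfrak a_0}(a)\wedge\lambda_{\mathfrak a_1}(b)\}$, $\rho(x)=\inf_{x=a+b}\{\rho_{\mathfrak a_0}(a)\vee\rho_{\mathfrak a_1}(b)\}$. A CIF vector subspace $A$ of $V$ is $\mathbb{Z}_2$-graded if $A=A_0\oplus A_1$ for some such $A_0,A_1$. A CIF set $A$ of $V$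 is a CIF Lie sub-superalgebra if it is a $\mathbb{Z}_2$-graded CIF vector subspace and $\lambda_A([x,y])\ge\lambda_A(x)\wedge\lambda_A(y)$, $\rho_A([x,y])\le\rho_A(x)\vee\rho_A(y)$ for all $x,y\in V$. It is a CIF ideal if it is a $\mathbb{Z}_2$-graded CIF vector subspace and $\lambda_A([x,y])\ge\lambda_A(x)\vee\lambda_A(y)$, $\rho_A([x,y])\le\rho_A(x)\wedge\rho_A(y)$ for all $x,y\in V$. For a function $\lambda=re^{i2\pi\omega}$ on $V$ with $r,\omega:V\to[0,1]$: $\mathrm{Im}(\lambda)=\{(r(x),\omega(x)) : x\in V\}\subseteq[0,1]\times[0,1]$, and for $t,s\in[0,1]$, $U(\lambda,(t,s))=\{x\in V: r(x)\ge t\text{ and }\omega(x)\ge s\}$, $L(\lambda,(t,s))=\{x\in V: r(x)\le t\text{ and }\omega(x)\le s\}$. *)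

theory Defs
  imports Complex_Main "HOL-Library.Product_Order" "HOL-Library.Z2"
begin

section \<open>Lie superalgebras\<close>

text \<open>
  The whole space is the type \<open>'v\<close>; the grading is a family \<open>V\<close> of subspaces indexed by the
  ring \<open>bit\<close> of integers mod 2, so the index \<open>i + j\<close> below is taken mod 2. A homogeneous element
  of degree \<open>i\<close> is a member of \<open>V i\<close>, and \<open>(- 1) ^ (of_bit i * of_bit j)\<close> is the sign
  $(-1)^{|x||y|}$ in the field. The field may have any characteristic, and no axioms are added
  in characteristic 2 or 3.
\<close>

locale lie_superalgebra = vector_space scale
  for scale :: "'k::field \<Rightarrow> 'v::ab_group_add \<Rightarrow> 'v" (infixr \<open>*s\<close> 75) +
  fixes V :: "bit \<Rightarrow> 'v set"
    and bracket :: "'v \<Rightarrow> 'v \<Rightarrow> 'v"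
  assumes subspace_grade: "subspace (V i)"
    and grade_sum: "{a + b | a b. a \<in> V 0 \<and> b \<in> V 1} = UNIV"
    and grade_inter: "V 0 \<inter> V 1 = {0}"
    and linear_bracket_left: "Vector_Spaces.linear scale scale (\<lambda>x. bracket x y)"
    and linear_bracket_right: "Vector_Spaces.linear scale scale (\<lambda>y. bracket x y)"
    and bracket_grade: "x \<in> V i \<Longrightarrow> y \<in> V j \<Longrightarrow> bracket x y \<in> V (i + j)"
    and bracket_skew: "x \<in> V i \<Longrightarrow> y \<in> V j \<Longrightarrow>
      bracket x y = - (((- 1) ^ (of_bit i * of_bit j)) *s bracket y x)"
    and bracket_jacobi: "x \<in> V i \<Longrightarrow> y \<in> V j \<Longrightarrow> z \<in> V k \<Longrightarrow>
      bracket x (bracket y z) - ((- 1) ^ (of_bit i * of_bit j)) *s bracket y (bracket x z)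
        = bracket (bracket x y) z"

definition graded_subspace ::
    "('k::field \<Rightarrow> 'v::ab_group_add \<Rightarrow> 'v) \<Rightarrow> (bit \<Rightarrow> 'v set) \<Rightarrow> 'v set \<Rightarrow> bool" where
  "graded_subspace scale V W \<longleftrightarrow>
     module.subspace scale W \<and> W = {a + b | a b. a \<in> W \<inter> V 0 \<and> b \<in> W \<inter> V 1}"

definition lie_sub_superalgebra ::
    "('k::field \<Rightarrow> 'v::ab_group_add \<Rightarrow> 'v) \<Rightarrow> (bit \<Rightarrow> 'v set) \<Rightarrow> ('v \<Rightarrow> 'v \<Rightarrow> 'v) \<Rightarrow> 'v set \<Rightarrow> bool" where
  "lie_sub_superalgebra scale V bracket W \<longleftrightarrow>
     graded_subspace scale V W \<and> (\<forall>x y. x \<in> W \<and> y \<in> W \<longrightarrow> bracket x y \<in> W)"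

definition lie_superideal ::
    "('k::field \<Rightarrow> 'v::ab_group_add \<Rightarrow> 'v) \<Rightarrow> (bit \<Rightarrow> 'v set) \<Rightarrow> ('v \<Rightarrow> 'v \<Rightarrow> 'v) \<Rightarrow> 'v set \<Rightarrow> bool" where
  "lie_superideal scale V bracket W \<longleftrightarrow>
     graded_subspace scale V W \<and> (\<forall>x y. x \<in> W \<or> y \<in> W \<longrightarrow> bracket x y \<in> W)"


section \<open>Complex intuitionistic fuzzy sets\<close>

text \<open>
  The value $\alpha e^{i2\pi\beta}$ is represented by the pair \<open>(\<alpha>, \<beta>)\<close>, so that the values
  1 and 0 are \<open>(1, 1)\<close> and \<open>(0, 0)\<close>; the phases 0 and 1 are thus kept apart. By
  \<^theory>\<open>HOL-Library.Product_Order\<close>, \<open>\<le>\<close>, \<open>inf\<close>, \<open>sup\<close>, \<open>Inf\<close> and \<open>Sup\<close> on pairs are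
  componentwise.
\<close>

record 'x cif =
  lam :: "'x \<Rightarrow> real \<times> real"
  rho :: "'x \<Rightarrow> real \<times> real"

text \<open>
  A set on \<open>X\<close> is a function on the whole type of which only the values on \<open>X\<close> matter. The
  amplitudes of the two functions are constrained jointly, the phases are not.
\<close>

definition cif_set_on :: "'x set \<Rightarrow> 'x cif \<Rightarrow> bool" where
  "cif_set_on X A \<longleftrightarrow>
     (\<forall>x\<in>X. lam A x \<in> {0..1} \<times> {0..1} \<and> rho A x \<in> {0..1} \<times> {0..1} \<and>
            fst (lam A x) + fst (rho A x) \<le> 1)"

definition cif_subspace_on ::
    "('k::field \<Rightarrow> 'v::ab_group_add \<Rightarrow> 'v) \<Rightarrow> 'v set \<Rightarrow> 'v cif \<Rightarrow> bool" where
  "cif_subspace_on scale W A \<longleftrightarrow>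
     cif_set_on W A \<and>
     (\<forall>x\<in>W. \<forall>y\<in>W. lam A (x + y) \<ge> inf (lam A x) (lam A y) \<and>
                   rho A (x + y) \<le> sup (rho A x) (rho A y)) \<and>
     (\<forall>c. \<forall>x\<in>W. lam A (scale c x) \<ge> lam A x \<and> rho A (scale c x) \<le> rho A x) \<and>
     lam A 0 = (1, 1) \<and> rho A 0 = (0, 0)"

definition cif_extend :: "'v set \<Rightarrow> 'v cif \<Rightarrow> 'v cif" where
  "cif_extend W A =
     \<lparr>lam = (\<lambda>x. if x \<in> W then lam A x else (0, 0)),
      rho = (\<lambda>x. if x \<in> W then rho A x else (1, 1))\<rparr>"

definition cif_sum :: "'v::ab_group_add cif \<Rightarrow> 'v cif \<Rightarrow> 'v cif" where
  "cif_sum A B =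
     \<lparr>lam = (\<lambda>x. Sup {inf (lam A a) (lam B b) | a b. x = a + b}),
      rho = (\<lambda>x. Inf {sup (rho A a) (rho B b) | a b. x = a + b})\<rparr>"

definition cif_graded_subspace ::
    "('k::field \<Rightarrow> 'v::ab_group_add \<Rightarrow> 'v) \<Rightarrow> (bit \<Rightarrow> 'v set) \<Rightarrow> 'v cif \<Rightarrow> bool" where
  "cif_graded_subspace scale V A \<longleftrightarrow>
     cif_subspace_on scale UNIV A \<and>
     (\<exists>A0 A1. cif_subspace_on scale (V 0) A0 \<and> cif_subspace_on scale (V 1) A1 \<and>
              A = cif_sum (cif_extend (V 0) A0) (cif_extend (V 1) A1))"

definition cif_lie_sub_superalgebra ::
    "('k::field \<Rightarrow> 'v::ab_group_add \<Rightarrow> 'v) \<Rightarrow> (bit \<Rightarrow> 'v set) \<Rightarrow> ('v \<Rightarrow> 'v \<Rightarrow> 'v) \<Rightarrow> 'v cif \<Rightarrow> bool" where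
  "cif_lie_sub_superalgebra scale V bracket A \<longleftrightarrow>
     cif_graded_subspace scale V A \<and>
     (\<forall>x y. lam A (bracket x y) \<ge> inf (lam A x) (lam A y) \<and>
            rho A (bracket x y) \<le> sup (rho A x) (rho A y))"

definition cif_ideal ::
    "('k::field \<Rightarrow> 'v::ab_group_add \<Rightarrow> 'v) \<Rightarrow> (bit \<Rightarrow> 'v set) \<Rightarrow> ('v \<Rightarrow> 'v \<Rightarrow> 'v) \<Rightarrow> 'v cif \<Rightarrow> bool" where
  "cif_ideal scale V bracket A \<longleftrightarrow>
     cif_graded_subspace scale V A \<and>
     (\<forall>x y. lam A (bracket x y) \<ge> sup (lam A x) (lam A y) \<and>
            rho A (bracket x y) \<le> inf (rho A x) (rho A y))"

definition upper_level :: "('x \<Rightarrow> real \<times> real) \<Rightarrow> real \<times> real \<Rightarrow> 'x set" where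
  "upper_level f = (\<lambda>(t, s). {x. fst (f x) \<ge> t \<and> snd (f x) \<ge> s})"

definition lower_level :: "('x \<Rightarrow> real \<times> real) \<Rightarrow> real \<times> real \<Rightarrow> 'x set" where
  "lower_level f = (\<lambda>(t, s). {x. fst (f x) \<le> t \<and> snd (f x) \<le> s})"

end

theory Submission
  imports Defs
begin

text \<open>
  Since the sum of \<open>V 0\<close> and \<open>V 1\<close> is direct, only one decomposition \<open>x = a + b\<close> contributes to
  the supremum and infimum defining \<open>A0 \<oplus> A1\<close>; taking \<open>b = 0\<close> or \<open>a = 0\<close> shows that \<open>A\<close> agrees with
  \<open>A0\<close> and \<open>A1\<close> on the homogeneous parts. Hence \<open>\<lambda>(a + b) = \<lambda>(a) \<and> \<lambda>(b)\<close> and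
  \<open>\<rho>(a + b) = \<rho>(a) \<or> \<rho>(b)\<close>, so a level set contains the homogeneous components of its elements.
  The remaining closure properties are read off from the defining inequalities.
\<close>

text \<open>With the componentwise order on pairs, membership becomes a single inequality, so
  lattice laws apply directly to level sets.\<close>

lemma upper_level_iff: "x \<in> upper_level f p \<longleftrightarrow> p \<le> f x"
  by (auto simp: upper_level_def less_eq_prod_def split: prod.splits)

lemma lower_level_iff: "x \<in> lower_level f p \<longleftrightarrow> f x \<le> p"
  by (auto simp: lower_level_def less_eq_prod_def split: prod.splits)

context lie_superalgebra
begin

text \<open>The element \<open>a - a'\<close> equals \<open>b' - b\<close>, so it lies in both
  grades, which meet only in 0.\<close>

lemma grade_decomp_unique:
  assumes "a \<in> V 0" "b \<in> V 1" "a' \<in> V 0" "b' \<in> V 1" "a + b = a' + b'"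
  shows "a = a'" "b = b'"
proof -
  have eq: "a - a' = b' - b"
    using assms(5) by (simp add: algebra_simps)
  have "a - a' \<in> V 0" "b' - b \<in> V 1"
    using assms subspace_diff subspace_grade by blast+
  then have "a - a' \<in> V 0 \<inter> V 1"
    using eq by simp
  then have "a - a' = 0"
    using grade_inter by blast
  then show "a = a'" "b = b'"
    using eq by auto
qed

lemma cif_sum_extend:
  assumes A0: "cif_subspace_on scale (V 0) A0" and A1: "cif_subspace_on scale (V 1) A1"
    and a: "a \<in> V 0" and b: "b \<in> V 1"
  defines "S \<equiv> cif_sum (cif_extend (V 0) A0) (cif_extend (V 1) A1)"
  shows "lam S (a + b) = inf (lam A0 a) (lam A1 b)"
    and "rho S (a + b) = sup (rho A0 a) (rho A1 b)"
proof -
  let ?B0 = "cif_extend (V 0) A0" and ?B1 = "cif_extend (V 1) A1"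
  \<comment> \<open>These bounds make the default values \<open>(0, 0)\<close> and
    \<open>(1, 1)\<close> of the extensions extremal: a decomposition that leaves the grades cannot
    improve on \<open>a + b\<close>.\<close>
  have unit: "(0, 0) \<le> lam A0 a" "(0, 0) \<le> lam A1 b" "rho A0 a \<le> (1, 1)" "rho A1 b \<le> (1, 1)"
    using A0 A1 a b by (auto simp: cif_subspace_on_def cif_set_on_def less_eq_prod_def mem_Times_iff)
  have uniq: "c = a \<and> d = b" if "c \<in> V 0" "d \<in> V 1" "a + b = c + d" for c d
    using grade_decomp_unique[OF a b that] by simp
  have lam_le: "inf (lam ?B0 c) (lam ?B1 d) \<le> inf (lam A0 a) (lam A1 b)" if "a + b = c + d" for c d
  proof (cases "c \<in> V 0 \<and> d \<in> V 1")
    case True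
    then show ?thesis
      using uniq that by (auto simp: cif_extend_def)
  next
    case False
    then have "inf (lam ?B0 c) (lam ?B1 d) \<le> (0, 0)"
      by (auto simp: cif_extend_def)
    also have "(0, 0) \<le> inf (lam A0 a) (lam A1 b)"
      using unit by simp
    finally show ?thesis .
  qed
  have rho_ge: "sup (rho A0 a) (rho A1 b) \<le> sup (rho ?B0 c) (rho ?B1 d)" if "a + b = c + d" for c d
  proof (cases "c \<in> V 0 \<and> d \<in> V 1")
    case True
    then show ?thesis
      using uniq that by (auto simp: cif_extend_def)
  next
    case False
    have "sup (rho A0 a) (rho A1 b) \<le> (1, 1)"
      using unit by simp
    also have "(1, 1) \<le> sup (rho ?B0 c) (rho ?B1 d)"
      using False by (auto simp: cif_extend_def)
    finally show ?thesis .
  qed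
  have "Sup {inf (lam ?B0 c) (lam ?B1 d) |c d. a + b = c + d} = inf (lam A0 a) (lam A1 b)"
  \<comment> \<open>The supremum is a maximum, attained at the graded decomposition.\<close>
  proof (rule cSup_eq_maximum)
    have "inf (lam A0 a) (lam A1 b) = inf (lam ?B0 a) (lam ?B1 b)"
      using a b by (simp add: cif_extend_def)
    then show "inf (lam A0 a) (lam A1 b) \<in> {inf (lam ?B0 c) (lam ?B1 d) |c d. a + b = c + d}"
      by blast
  qed (use lam_le in blast)
  then show "lam S (a + b) = inf (lam A0 a) (lam A1 b)"
    by (simp add: S_def cif_sum_def)
  have "Inf {sup (rho ?B0 c) (rho ?B1 d) |c d. a + b = c + d} = sup (rho A0 a) (rho A1 b)"
  proof (rule cInf_eq_minimum)
    have "sup (rho A0 a) (rho A1 b) = sup (rho ?B0 a) (rho ?B1 b)"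
      using a b by (simp add: cif_extend_def)
    then show "sup (rho A0 a) (rho A1 b) \<in> {sup (rho ?B0 c) (rho ?B1 d) |c d. a + b = c + d}"
      by blast
  qed (use rho_ge in blast)
  then show "rho S (a + b) = sup (rho A0 a) (rho A1 b)"
    by (simp add: S_def cif_sum_def)
qed

text \<open>This removes the witnesses \<open>A0\<close> and \<open>A1\<close>, leaving a statement
  about \<open>A\<close> alone.\<close>

lemma cif_graded_subspace_homogeneous:
  assumes "cif_graded_subspace scale V A" and a: "a \<in> V 0" and b: "b \<in> V 1"
  shows "lam A (a + b) = inf (lam A a) (lam A b)"
    and "rho A (a + b) = sup (rho A a) (rho A b)"
proof -
  obtain A0 A1 where A0: "cif_subspace_on scale (V 0) A0" and A1: "cif_subspace_on scale (V 1) A1"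
    and A: "A = cif_sum (cif_extend (V 0) A0) (cif_extend (V 1) A1)"
    using assms(1) unfolding cif_graded_subspace_def by blast
  have zero: "0 \<in> V i" for i
    using subspace_grade subspace_0 by blast
  \<comment> \<open>The normalised values at 0 are neutral for \<open>inf\<close> and
    \<open>sup\<close> on the unit square, so the decompositions \<open>a + 0\<close> and
    \<open>0 + b\<close> return the values of \<open>A0\<close> and \<open>A1\<close>.\<close>
  have at0: "lam A0 0 = (1, 1)" "rho A0 0 = (0, 0)" "lam A1 0 = (1, 1)" "rho A1 0 = (0, 0)"
    using A0 A1 by (auto simp: cif_subspace_on_def)
  have unit0: "lam A0 a \<le> (1, 1)" "(0, 0) \<le> rho A0 a"
    using A0 a by (auto simp: cif_subspace_on_def cif_set_on_def less_eq_prod_def mem_Times_iff)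
  have unit1: "lam A1 b \<le> (1, 1)" "(0, 0) \<le> rho A1 b"
    using A1 b by (auto simp: cif_subspace_on_def cif_set_on_def less_eq_prod_def mem_Times_iff)
  note sum = cif_sum_extend[OF A0 A1, folded A]
  have "lam A a = lam A0 a" "rho A a = rho A0 a"
    using sum[OF a zero] at0 unit0 by (simp_all add: inf_absorb1 sup_absorb1)
  moreover have "lam A b = lam A1 b" "rho A b = rho A1 b"
    using sum[OF zero b] at0 unit1 by (simp_all add: inf_absorb2 sup_absorb2)
  ultimately show "lam A (a + b) = inf (lam A a) (lam A b)"
    and "rho A (a + b) = sup (rho A a) (rho A b)"
    using sum[OF a b] by simp_all
qed

text \<open>Every element splits by \<open>grade_sum\<close>, and the hypothesis keeps both parts in
  \<open>W\<close>; the reverse inclusion is closure under addition.\<close>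

lemma graded_subspaceI:
  assumes "subspace W" and "\<And>a b. a \<in> V 0 \<Longrightarrow> b \<in> V 1 \<Longrightarrow> a + b \<in> W \<Longrightarrow> a \<in> W \<and> b \<in> W"
  shows "graded_subspace scale V W"
proof -
  have "\<exists>a b. x = a + b \<and> a \<in> W \<inter> V 0 \<and> b \<in> W \<inter> V 1" if "x \<in> W" for x
  proof -
    obtain a b where "a \<in> V 0" "b \<in> V 1" "x = a + b"
      using grade_sum by blast
    then show ?thesis
      using assms(2) that by blast
  qed
  then show ?thesis
    using assms(1) subspace_add unfolding graded_subspace_def by blast
qed

text \<open>The bound on \<open>p\<close> puts 0 into the level set. Closure under homogeneous parts
  holds because \<open>p\<close> is below an \<open>inf\<close> exactly when it is below both
  arguments.\<close>

lemma graded_subspace_upper_level: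
  assumes A: "cif_graded_subspace scale V A" and p: "p \<le> (1, 1)"
  shows "graded_subspace scale V (upper_level (lam A) p)"
proof (rule graded_subspaceI)
  have "inf (lam A x) (lam A y) \<le> lam A (x + y)" "lam A x \<le> lam A (c *s x)" "lam A 0 = (1, 1)"
    for x y c
    using A by (auto simp: cif_graded_subspace_def cif_subspace_on_def)
  then show "subspace (upper_level (lam A) p)"
    using p by (auto simp: subspace_def upper_level_iff intro: order_trans[OF le_infI] order_trans)
qed (simp add: upper_level_iff cif_graded_subspace_homogeneous[OF A])

text \<open>The order dual of the previous argument: 0 belongs because \<open>rho A 0\<close> is
  \<open>(0, 0)\<close>, and a \<open>sup\<close> is below \<open>p\<close> exactly when both
  arguments are.\<close>

lemma graded_subspace_lower_level:
  assumes A: "cif_graded_subspace scale V A" and p: "(0, 0) \<le> p"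
  shows "graded_subspace scale V (lower_level (rho A) p)"
proof (rule graded_subspaceI)
  have "rho A (x + y) \<le> sup (rho A x) (rho A y)" "rho A (c *s x) \<le> rho A x" "rho A 0 = (0, 0)"
    for x y c
    using A by (auto simp: cif_graded_subspace_def cif_subspace_on_def)
  then show "subspace (lower_level (rho A) p)"
    using p by (auto simp: subspace_def lower_level_iff
        intro: order_trans[rotated, OF le_supI] order_trans[rotated])
qed (simp add: lower_level_iff cif_graded_subspace_homogeneous[OF A])

lemma lie_sub_superalgebra_levels:
  assumes A: "cif_lie_sub_superalgebra scale V bracket A" and p: "(0, 0) \<le> p" "p \<le> (1, 1)"
  shows "lie_sub_superalgebra scale V bracket (upper_level (lam A) p)"
    and "lie_sub_superalgebra scale V bracket (lower_level (rho A) p)"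
proof -
  have g: "cif_graded_subspace scale V A"
    and "inf (lam A x) (lam A y) \<le> lam A (bracket x y)"
    and "rho A (bracket x y) \<le> sup (rho A x) (rho A y)" for x y
    using A by (auto simp: cif_lie_sub_superalgebra_def)
  then show "lie_sub_superalgebra scale V bracket (upper_level (lam A) p)"
    and "lie_sub_superalgebra scale V bracket (lower_level (rho A) p)"
    using graded_subspace_upper_level[OF g p(2)] graded_subspace_lower_level[OF g p(1)]
    by (auto simp: lie_sub_superalgebra_def upper_level_iff lower_level_iff
        intro: order_trans[OF le_infI] order_trans[rotated, OF le_supI])
qed

lemma lie_superideal_levels:
  assumes A: "cif_ideal scale V bracket A" and p: "(0, 0) \<le> p" "p \<le> (1, 1)"
  shows "lie_superideal scale V bracket (upper_level (lam A) p)"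
    and "lie_superideal scale V bracket (lower_level (rho A) p)"
proof -
  have g: "cif_graded_subspace scale V A"
    \<comment> \<open>Splitting the \<open>sup\<close> and \<open>inf\<close> of the ideal
      inequalities gives a bound by each argument separately, as an ideal requires only one argument
      in the level set.\<close>
    and "lam A x \<le> lam A (bracket x y)" "lam A y \<le> lam A (bracket x y)"
    and "rho A (bracket x y) \<le> rho A x" "rho A (bracket x y) \<le> rho A y" for x y
    using A by (auto simp: cif_ideal_def)
  then show "lie_superideal scale V bracket (upper_level (lam A) p)"
    and "lie_superideal scale V bracket (lower_level (rho A) p)"
    using graded_subspace_upper_level[OF g p(2)] graded_subspace_lower_level[OF g p(1)]
    by (auto simp: lie_superideal_def upper_level_iff lower_level_iff
        intro: order_trans order_trans[rotated])
qed

end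

text \<open>Values of a CIF set lie in the unit square; this supplies the bounds that place 0 in
  both level sets.\<close>

lemma range_lam_unit:
  assumes "cif_graded_subspace scale V A" and "p \<in> range (lam A)"
  shows "(0, 0) \<le> p" "p \<le> (1, 1)"
  using assms
  by (auto simp: cif_graded_subspace_def cif_subspace_on_def cif_set_on_def less_eq_prod_def
      mem_Times_iff)

theorem theorem3p6:
  fixes scale :: "'k::field \<Rightarrow> 'v::ab_group_add \<Rightarrow> 'v"
    and V :: "bit \<Rightarrow> 'v set"
    and bracket :: "'v \<Rightarrow> 'v \<Rightarrow> 'v"
    and A :: "'v cif"
  assumes "lie_superalgebra scale V bracket"
  shows "(cif_lie_sub_superalgebra scale V bracket A \<longrightarrow>
            (\<forall>t s. (t, s) \<in> range (lam A) \<inter> range (rho A) \<longrightarrow>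
               lie_sub_superalgebra scale V bracket (upper_level (lam A) (t, s)) \<and>
               lie_sub_superalgebra scale V bracket (lower_level (rho A) (t, s))))
       \<and> (cif_ideal scale V bracket A \<longrightarrow>
            (\<forall>t s. (t, s) \<in> range (lam A) \<inter> range (rho A) \<longrightarrow>
               lie_superideal scale V bracket (upper_level (lam A) (t, s)) \<and>
               lie_superideal scale V bracket (lower_level (rho A) (t, s))))"
proof -
  interpret lie_superalgebra scale V bracket
    by fact
  show ?thesis
  proof (intro conjI impI allI; elim IntE)
    fix t s
    assume A: "cif_lie_sub_superalgebra scale V bracket A" and "(t, s) \<in> range (lam A)"
    then have "(0, 0) \<le> (t, s)" "(t, s) \<le> (1, 1)"
      using range_lam_unit unfolding cif_lie_sub_superalgebra_def by blast+
    then show "lie_sub_superalgebra scale V bracket (upper_level (lam A) (t, s))"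
      and "lie_sub_superalgebra scale V bracket (lower_level (rho A) (t, s))"
      by (rule lie_sub_superalgebra_levels[OF A])+
  next
    fix t s
    assume A: "cif_ideal scale V bracket A" and "(t, s) \<in> range (lam A)"
    then have "(0, 0) \<le> (t, s)" "(t, s) \<le> (1, 1)"
      using range_lam_unit unfolding cif_ideal_def by blast+
    then show "lie_superideal scale V bracket (upper_level (lam A) (t, s))"
      and "lie_superideal scale V bracket (lower_level (rho A) (t, s))"
      by (rule lie_superideal_levels[OF A])+
  qed
qed

end
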